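(* Let $(X,T)$ be a minimal dynamical system. Then $(X,T)$ is either pairwise thickly sensitive or pairwise syndetically equicontinuous.
   Context: A dynamical system is a pair $(X,T)$ where $X$ is a compact metric space with metric $d$ and $T\colon X\to X$ is a continuous surjection. $\mathbb{N}$ is the set of positive integers. A subsystem is a non-empty closed $Y\subset X$ with $TY\subset Y$; a system is minimal if it has no proper subsystem. A set $F\subset\mathbb{N}$ is thick if for every $L\in\mathbb{N}$ there is $m\in\mathbb{N}$ with $\{m,m+1,\dots,m+L\}\subset F$; it is syndetic if there is $M\in\mathbb{N}$ with $F\cap\{m,m+1,\dots,m+M\}\ne\emptyset$ for all $m\in\mathbb{N}$. $(X,T)$ is pairwise thickly sensitive if there is $\delta>0$ such that for every non-empty open $U\subset X$ there exist $x_1,x_2\in U$ such that $\{k\in\mathbb{N}: d(T^kx_1,T^kx_2)>\delta\}$ is thick. A point $x\in X$ is pairwise syndetically equicontinuous if for every $\varepsilon>0$ there is a neighbourhood $U$ of $x$ such that for all $y,z\in U$, $\{k\in\mathbb{N}:d(T^ky,T^kz)<\varepsilon\}$ is syndetic. $(X,T)$ is pairwise syndetically equicontinuous if every point of $X$ is pairwise syndetically equicontinuous. *)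

theory Defs
  imports "HOL-Analysis.Analysis"
begin

text \<open>The positive integers are the naturals \<open>k \<ge> 1\<close>; all sets of times are subsets of these.\<close>

definition thick :: "nat set \<Rightarrow> bool" where
  "thick F \<longleftrightarrow> F \<subseteq> {1..} \<and> (\<forall>L\<ge>1. \<exists>m\<ge>1. {m..m + L} \<subseteq> F)"

definition syndetic :: "nat set \<Rightarrow> bool" where
  "syndetic F \<longleftrightarrow> F \<subseteq> {1..} \<and> (\<exists>M\<ge>1. \<forall>m\<ge>1. F \<inter> {m..m + M} \<noteq> {})"

text \<open>
  The phase space is a compact subset \<open>X\<close> of a metric space type, with the induced metric and
  topology (\<open>X = UNIV\<close> is allowed). The values of \<open>T\<close> outside \<open>X\<close> are irrelevant.
  Phase spaces are non-empty, in accordance with the requirement that subsystems be non-empty.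
\<close>

definition dynamical_system :: "'a::metric_space set \<Rightarrow> ('a \<Rightarrow> 'a) \<Rightarrow> bool" where
  "dynamical_system X T \<longleftrightarrow> X \<noteq> {} \<and> compact X \<and> continuous_on X T \<and> T ` X = X"

definition subsystem :: "'a::metric_space set \<Rightarrow> ('a \<Rightarrow> 'a) \<Rightarrow> 'a set \<Rightarrow> bool" where
  "subsystem X T Y \<longleftrightarrow> Y \<noteq> {} \<and> closedin (top_of_set X) Y \<and> T ` Y \<subseteq> Y"

definition minimal_system :: "'a::metric_space set \<Rightarrow> ('a \<Rightarrow> 'a) \<Rightarrow> bool" where
  "minimal_system X T \<longleftrightarrow> dynamical_system X T \<and> \<not> (\<exists>Y. subsystem X T Y \<and> Y \<subset> X)"

definition pairwise_thickly_sensitive :: "'a::metric_space set \<Rightarrow> ('a \<Rightarrow> 'a) \<Rightarrow> bool" where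
  "pairwise_thickly_sensitive X T \<longleftrightarrow>
    (\<exists>\<delta>>0. \<forall>U. openin (top_of_set X) U \<and> U \<noteq> {} \<longrightarrow>
      (\<exists>x1\<in>U. \<exists>x2\<in>U. thick {k. k \<ge> 1 \<and> dist ((T ^^ k) x1) ((T ^^ k) x2) > \<delta>}))"

text \<open>
  Neighbourhoods are taken to be open. This loses nothing, since the condition on \<open>U\<close> is
  inherited by subsets of \<open>U\<close>.
\<close>

definition pairwise_syndetically_equicontinuous_at ::
  "'a::metric_space set \<Rightarrow> ('a \<Rightarrow> 'a) \<Rightarrow> 'a \<Rightarrow> bool" where
  "pairwise_syndetically_equicontinuous_at X T x \<longleftrightarrow>
    (\<forall>\<epsilon>>0. \<exists>U. openin (top_of_set X) U \<and> x \<in> U \<and>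
      (\<forall>y\<in>U. \<forall>z\<in>U. syndetic {k. k \<ge> 1 \<and> dist ((T ^^ k) y) ((T ^^ k) z) < \<epsilon>}))"

definition pairwise_syndetically_equicontinuous ::
  "'a::metric_space set \<Rightarrow> ('a \<Rightarrow> 'a) \<Rightarrow> bool" where
  "pairwise_syndetically_equicontinuous X T \<longleftrightarrow>
    (\<forall>x\<in>X. pairwise_syndetically_equicontinuous_at X T x)"

end

theory Submission
  imports Defs
begin

text \<open>
  If pairwise thick sensitivity fails at scale \<open>\<epsilon> / 2\<close>, some non-empty open \<open>U\<close> has all its pairs
  syndetically often \<open>\<epsilon>\<close>-close. By minimality every point enters \<open>U\<close> at some time \<open>n\<close>, so the
  preimage of \<open>U\<close> under \<open>T ^^ n\<close> is a neighbourhood with the same property, as shifting by \<open>n\<close>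
  preserves syndeticity. Exclusivity holds because a thick set meets every syndetic set.
\<close>

text \<open>A thick set contains an interval as long as the window length \<open>M\<close> of the
  syndetic set.\<close>

lemma thick_inter_syndetic:
  assumes "thick F" "syndetic S"
  shows "F \<inter> S \<noteq> {}"
proof -
  obtain M where "M \<ge> 1" and M: "\<forall>m\<ge>1. S \<inter> {m..m + M} \<noteq> {}"
    using assms(2) by (auto simp: syndetic_def)
  then obtain m where "m \<ge> 1" "{m..m + M} \<subseteq> F"
    using assms(1) unfolding thick_def by blast
  with M show ?thesis by blast
qed

text \<open>A length \<open>L\<close> at which thickness of \<open>F\<close> fails is a window
  length for the complement: every \<open>{m..m + L}\<close> has a point outside
  \<open>F\<close>.\<close>

lemma syndetic_if_not_thick:
  assumes "\<not> thick F" "F \<subseteq> {1..}"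
  shows "syndetic ({1..} - F)"
proof -
  obtain L where "L \<ge> 1" and L: "\<forall>m\<ge>1. \<not> {m..m + L} \<subseteq> F"
    using assms by (auto simp: thick_def)
  have "({1..} - F) \<inter> {m..m + L} \<noteq> {}" if m: "m \<ge> 1" for m
  proof -
    obtain k where "k \<in> {m..m + L}" "k \<notin> F" using L m by blast
    with m have "k \<in> ({1..} - F) \<inter> {m..m + L}" by auto
    then show ?thesis by blast
  qed
  with \<open>L \<ge> 1\<close> show ?thesis by (auto simp: syndetic_def)
qed

text \<open>Lengthening the window by \<open>n\<close> absorbs the translation. Asking only for an
  inclusion into \<open>S'\<close> covers passing to a superset as well.\<close>

lemma syndetic_shift:
  assumes "syndetic S" "(\<lambda>k. k + n) ` S \<subseteq> S'" "S' \<subseteq> {1..}"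
  shows "syndetic S'"
proof -
  obtain M where M: "M \<ge> 1" "\<forall>m\<ge>1. S \<inter> {m..m + M} \<noteq> {}"
    using assms(1) by (auto simp: syndetic_def)
  have "S' \<inter> {m..m + (M + n)} \<noteq> {}" if m: "m \<ge> 1" for m
  proof -
    obtain k where "k \<in> S" "k \<in> {m..m + M}" using M(2) m by blast
    then have "k + n \<in> S' \<inter> {m..m + (M + n)}" using assms(2) by auto
    then show ?thesis by blast
  qed
  with M(1) assms(3) show ?thesis
    unfolding syndetic_def by (meson trans_le_add1)
qed

lemma funpow_image_subset:
  assumes "T ` X \<subseteq> X"
  shows "(T ^^ n) ` X \<subseteq> X"
  using assms by (induction n) auto

lemma continuous_on_funpow:
  assumes "continuous_on X T" "T ` X \<subseteq> X"
  shows "continuous_on X (T ^^ n)"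
proof (induction n)
  case (Suc n)
  have "continuous_on ((T ^^ n) ` X) T"
    using assms(1) funpow_image_subset[OF assms(2)] by (rule continuous_on_subset)
  with Suc show ?case
    unfolding funpow.simps(2) by (rule continuous_on_compose)
qed (simp add: id_def)

lemma openin_funpow_vimage:
  assumes "continuous_on X T" "T ` X \<subseteq> X" "openin (top_of_set X) U"
  shows "openin (top_of_set X) (X \<inter> (T ^^ n) -` U)"
  using continuous_on_funpow[OF assms(1,2)] _ assms(3)
  by (rule continuous_openin_preimage) (use funpow_image_subset[OF assms(2)] in blast)

text \<open>The points whose orbits avoid \<open>U\<close> form a closed forward-invariant set,
  which would be a proper subsystem if it were non-empty.\<close>

lemma minimal_system_hits_open:
  assumes "minimal_system X T" "openin (top_of_set X) U" "U \<noteq> {}" "x \<in> X"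
  obtains n where "(T ^^ n) x \<in> U"
proof -
  have T: "continuous_on X T" "T ` X \<subseteq> X"
    using assms(1) by (auto simp: minimal_system_def dynamical_system_def)
  define Y where "Y = X - (\<Union>n. X \<inter> (T ^^ n) -` U)"
  have Y_iff: "z \<in> Y \<longleftrightarrow> z \<in> X \<and> (\<forall>n. (T ^^ n) z \<notin> U)" for z
    by (auto simp: Y_def)
  have "closedin (top_of_set X) Y"
    unfolding Y_def using openin_funpow_vimage[OF T assms(2)]
    by (intro closedin_diff closedin_subtopology_refl[THEN iffD2] openin_Union) auto
  moreover have "T ` Y \<subseteq> Y"
  proof
    fix y assume "y \<in> T ` Y"
    then obtain z where "z \<in> Y" and y: "y = T z" by blast
    then have z: "z \<in> X" "\<forall>n. (T ^^ n) z \<notin> U" using Y_iff[of z] by blast+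
    \<comment> \<open>The orbit of \<open>y = T z\<close> is the orbit of \<open>z\<close> from time
      1 on.\<close>
    have "(T ^^ n) y \<notin> U" for n
      using z(2)[rule_format, of "Suc n"] by (simp add: y funpow_swap1)
    with z y T(2) show "y \<in> Y" by (auto simp: Y_iff)
  qed
  moreover have "Y \<subset> X"
  proof -
    obtain u where "u \<in> U" using assms(3) by blast
    moreover have "u \<in> X" using assms(2) \<open>u \<in> U\<close> openin_imp_subset by blast
    \<comment> \<open>Orbits start at time 0, so a point of \<open>U\<close> already visits
      \<open>U\<close>.\<close>
    moreover have "u \<notin> Y" using \<open>u \<in> U\<close> Y_iff[of u] by (metis funpow_0)
    ultimately show ?thesis using Y_iff by blast
  qed
  ultimately have "Y = {}"
    using assms(1) unfolding minimal_system_def subsystem_def by blast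
  with assms(4) that Y_iff[of x] show ?thesis by blast
qed

lemma pairwise_syndetically_equicontinuous_if_not_sensitive:
  assumes min: "minimal_system X T" and not_sens: "\<not> pairwise_thickly_sensitive X T"
  shows "pairwise_syndetically_equicontinuous X T"
  unfolding pairwise_syndetically_equicontinuous_def
    pairwise_syndetically_equicontinuous_at_def
proof (intro ballI allI impI)
  fix x and \<epsilon> :: real
  assume x: "x \<in> X" and "\<epsilon> > 0"
  have T: "continuous_on X T" "T ` X \<subseteq> X"
    using min by (auto simp: minimal_system_def dynamical_system_def)
  \<comment> \<open>Half of \<epsilon> is used because the complement of \<open>far y z\<close> only
    gives distance \<le> \<epsilon> / 2, while a strict bound by \<epsilon> is wanted.\<close>
  define far where "far y z = {k. k \<ge> 1 \<and> dist ((T ^^ k) y) ((T ^^ k) z) > \<epsilon> / 2}" for y z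
  have "\<epsilon> / 2 > 0" using \<open>\<epsilon> > 0\<close> by simp
  then obtain U where U: "openin (top_of_set X) U" "U \<noteq> {}"
    and not_thick: "\<And>y z. y \<in> U \<Longrightarrow> z \<in> U \<Longrightarrow> \<not> thick (far y z)"
    using not_sens unfolding pairwise_thickly_sensitive_def far_def by meson
  obtain n where n: "(T ^^ n) x \<in> U"
    using minimal_system_hits_open[OF min U x] .
  have "syndetic {k. k \<ge> 1 \<and> dist ((T ^^ k) y) ((T ^^ k) z) < \<epsilon>}"
    if "(T ^^ n) y \<in> U" "(T ^^ n) z \<in> U" for y z
  proof (rule syndetic_shift)
    show "syndetic ({1..} - far ((T ^^ n) y) ((T ^^ n) z))"
      using not_thick[OF that] by (rule syndetic_if_not_thick) (auto simp: far_def)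
    \<comment> \<open>Time \<open>k\<close> for the points \<open>(T ^^ n) y\<close> and
      \<open>(T ^^ n) z\<close> is time \<open>k + n\<close> for \<open>y\<close> and
      \<open>z\<close>.\<close>
    show "(\<lambda>k. k + n) ` ({1..} - far ((T ^^ n) y) ((T ^^ n) z))
        \<subseteq> {k. k \<ge> 1 \<and> dist ((T ^^ k) y) ((T ^^ k) z) < \<epsilon>}"
      using \<open>\<epsilon> > 0\<close> by (auto simp: far_def funpow_add)
  qed auto
  then show "\<exists>V. openin (top_of_set X) V \<and> x \<in> V \<and>
      (\<forall>y\<in>V. \<forall>z\<in>V. syndetic {k. k \<ge> 1 \<and> dist ((T ^^ k) y) ((T ^^ k) z) < \<epsilon>})"
    using openin_funpow_vimage[OF T U(1), of n] n x
    by (intro exI[of _ "X \<inter> (T ^^ n) -` U"]) auto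
qed

text \<open>Apply equicontinuity at \<open>x\<close> with the sensitivity constant \<delta> as
  \<epsilon>. Some pair in the resulting neighbourhood is far apart on a thick set of times and
  close on a syndetic one, and a common time gives a distance both above and below \<delta>.\<close>

lemma not_sensitive_and_equicontinuous_at:
  assumes "pairwise_thickly_sensitive X T" "x \<in> X"
  shows "\<not> pairwise_syndetically_equicontinuous_at X T x"
proof
  assume eq: "pairwise_syndetically_equicontinuous_at X T x"
  obtain \<delta> where "\<delta> > 0" and sens: "\<And>U. openin (top_of_set X) U \<Longrightarrow> U \<noteq> {} \<Longrightarrow>
      \<exists>y\<in>U. \<exists>z\<in>U. thick {k. k \<ge> 1 \<and> dist ((T ^^ k) y) ((T ^^ k) z) > \<delta>}"
    using assms(1) unfolding pairwise_thickly_sensitive_def by blast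
  obtain U where "openin (top_of_set X) U" "x \<in> U"
    and synd: "\<forall>y\<in>U. \<forall>z\<in>U. syndetic {k. k \<ge> 1 \<and> dist ((T ^^ k) y) ((T ^^ k) z) < \<delta>}"
    using eq \<open>\<delta> > 0\<close> unfolding pairwise_syndetically_equicontinuous_at_def by blast
  then obtain y z where "y \<in> U" "z \<in> U"
    and thick: "thick {k. k \<ge> 1 \<and> dist ((T ^^ k) y) ((T ^^ k) z) > \<delta>}"
    using sens[of U] by blast
  from \<open>y \<in> U\<close> \<open>z \<in> U\<close> synd
  have "syndetic {k. k \<ge> 1 \<and> dist ((T ^^ k) y) ((T ^^ k) z) < \<delta>}" by blast
  from thick_inter_syndetic[OF thick this] show False by auto
qed

theorem corollary4p14:
  fixes X :: "'a::metric_space set" and T :: "'a \<Rightarrow> 'a"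
  assumes "minimal_system X T"
  shows "(pairwise_thickly_sensitive X T \<or> pairwise_syndetically_equicontinuous X T)
    \<and> \<not> (pairwise_thickly_sensitive X T \<and> pairwise_syndetically_equicontinuous X T)"
proof -
  \<comment> \<open>Exclusivity rests on having a point: on an empty space both properties would
    hold vacuously.\<close>
  obtain x where "x \<in> X"
    using assms by (auto simp: minimal_system_def dynamical_system_def)
  then show ?thesis
    using pairwise_syndetically_equicontinuous_if_not_sensitive[OF assms]
      not_sensitive_and_equicontinuous_at
    unfolding pairwise_syndetically_equicontinuous_def by blast
qed

end
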